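(* Let $(G,u)$ be a unital $\ell$-group such that $[0,u]$ is not of the form $\{0,u\}$, $\{0,u,x\}$ or $\{0,u,x,u-x\}$ for any $x$, and let $C=G/\mathbb{Z}u$ be its wound-round. Then $C\in\mathcal{AC}$, and the MV-algebra $A(C)\cup\{\mathbb{1}\}$ (with $\neg0=\mathbb{1}$, $\neg\mathbb{1}=0$, $\neg x=-x$ for $x\in A(C)\setminus\{0\}$, and $x\oplus y=x\wedge_0(\neg y)+y$ if this is $\neq0$ or $x=y=0$, $x\oplus y=\mathbb{1}$ otherwise) is isomorphic to the MV-algebra $\Gamma(G,u)$.
   Context: A unital $\ell$-group is a lattice-ordered abelian group with distinguished strong unit $u>0$; $\Gamma(G,u)$ is $[0,u]=\{x\mid0\le x\le u\}$ with $x\oplus y=(x+y)\wedge u$, $\neg x=u-x$, $0$. The wound-round $C=G/\mathbb{Z}u$ (canonical map $\rho$) carries $R(\rho(x_1),\rho(x_2),\rho(x_3))$ iff $\exists n_2,n_3\in\mathbb{Z}$, $x_1<x_2+n_2u<x_3+n_3u<x_1+u$; $y\le_0z$ means $R(0,y,z)$ or $y=z$ or $y=0$. $A(C)$ consists of $0$ and all $x\ne0$ such that some $y\ne0$ satisfies $x<_0y$ or $y<_0x$. Adjoin $\mathbb{1}$ with $x<_0\mathbb{1}$ and $\mathbb{1}+x=x+\mathbb{1}=x$ for $x\in A(C)$; $\wedge_0,\vee_0$ are infimum/supremum in $(A(C)\cup\{\mathbb{1}\},\le_0)$. $\mathcal{AC}$ is the class of p.c.o. groups with: (1) $x<_0y\Leftrightarrow-y<_0-x$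 for $x,y\in A(C)\setminus\{0\}$; (2) $(A(C)\cup\{\mathbb{1}\},\le_0)$ is a distributive lattice; (3) $x+y=x\wedge_0y+x\vee_0y$ for $x,y\in A(C)$; (4) $x-y=(x\wedge_0(-z)+z)\wedge_0(-y)-(y\wedge_0(-z)+z)\wedge_0(-x)$ for $x,y,z\in A(C)\setminus\{0\}$.
   Formalization: In condition (4) of the class AC, the sums x∧₀(−z)+z and y∧₀(−z)+z are read as x⊕z and y⊕z, so a sum that vanishes in C counts as 𝟙 instead of 0; as printed, (4) fails, e.g. in ℝ/ℤ with x=9/10, y=1/5, z=1/2. *)

theory Defs
  imports "HOL-Library.Lattice_Algebras" "HOL-Algebra.Coset"
begin

section \<open>Partially cyclically ordered groups\<close>

text \<open>
  Lattice-ordered abelian groups are types of class \<open>lattice_ab_group_add\<close>. Partially cyclically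
  ordered groups arise as quotients, so they live on carriers: an abelian group \<open>C\<close> in the sense
  of HOL-Algebra (whose \<open>\<otimes>\<close>, \<open>\<one>\<close>, \<open>inv\<close> stand for the additive \<open>+\<close>, \<open>0\<close>, \<open>-\<close>), together with a
  ternary relation \<open>R\<close>.
\<close>

definition cle :: "('c \<Rightarrow> 'c \<Rightarrow> 'c \<Rightarrow> bool) \<Rightarrow> 'c \<Rightarrow> 'c \<Rightarrow> 'c \<Rightarrow> bool" where
  "cle R x y z \<longleftrightarrow> R x y z \<or> y = z \<or> y = x"

locale pco_group = comm_group C for C :: "'c monoid" (structure) +
  fixes R :: "'c \<Rightarrow> 'c \<Rightarrow> 'c \<Rightarrow> bool"
  assumes strict: "\<lbrakk>x \<in> carrier C; y \<in> carrier C; z \<in> carrier C; R x y z\<rbrakk>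
      \<Longrightarrow> x \<noteq> y \<and> y \<noteq> z \<and> z \<noteq> x"
    and cyclic: "\<lbrakk>x \<in> carrier C; y \<in> carrier C; z \<in> carrier C; R x y z\<rbrakk> \<Longrightarrow> R y z x"
    and order: "x \<in> carrier C
      \<Longrightarrow> partial_order \<lparr>carrier = carrier C, eq = (=), le = cle R x\<rparr>"
    and compatible: "\<lbrakk>x \<in> carrier C; y \<in> carrier C; z \<in> carrier C; v \<in> carrier C; R x y z\<rbrakk>
      \<Longrightarrow> R (x \<otimes> v) (y \<otimes> v) (z \<otimes> v)"

definition le0 :: "'c monoid \<Rightarrow> ('c \<Rightarrow> 'c \<Rightarrow> 'c \<Rightarrow> bool) \<Rightarrow> 'c \<Rightarrow> 'c \<Rightarrow> bool" where
  "le0 C R = cle R \<one>\<^bsub>C\<^esub>"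

definition less0 :: "'c monoid \<Rightarrow> ('c \<Rightarrow> 'c \<Rightarrow> 'c \<Rightarrow> bool) \<Rightarrow> 'c \<Rightarrow> 'c \<Rightarrow> bool" where
  "less0 C R y z \<longleftrightarrow> le0 C R y z \<and> y \<noteq> z"

definition A_of :: "'c monoid \<Rightarrow> ('c \<Rightarrow> 'c \<Rightarrow> 'c \<Rightarrow> bool) \<Rightarrow> 'c set" where
  "A_of C R = {x \<in> carrier C. x = \<one>\<^bsub>C\<^esub> \<or>
     (x \<noteq> \<one>\<^bsub>C\<^esub> \<and> (\<exists>y\<in>carrier C. y \<noteq> \<one>\<^bsub>C\<^esub> \<and> (less0 C R x y \<or> less0 C R y x)))}"

section \<open>Adjoining a greatest element\<close>

datatype 'c adj = El (elt: 'c) | Top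

fun adj_le :: "'c monoid \<Rightarrow> ('c \<Rightarrow> 'c \<Rightarrow> 'c \<Rightarrow> bool) \<Rightarrow> 'c adj \<Rightarrow> 'c adj \<Rightarrow> bool" where
  "adj_le C R (El x) (El y) \<longleftrightarrow> le0 C R x y"
| "adj_le C R x Top \<longleftrightarrow> True"
| "adj_le C R Top (El y) \<longleftrightarrow> False"

definition A_top :: "'c monoid \<Rightarrow> ('c \<Rightarrow> 'c \<Rightarrow> 'c \<Rightarrow> bool) \<Rightarrow> 'c adj gorder" where
  "A_top C R = \<lparr>carrier = El ` A_of C R \<union> {Top}, eq = (=), le = adj_le C R\<rparr>"

text \<open>\<open>Top + Top\<close> is left open by the convention \<open>Top + x = x + Top = x\<close>; it is never used.\<close>

fun adj_add :: "'c monoid \<Rightarrow> 'c adj \<Rightarrow> 'c adj \<Rightarrow> 'c adj" where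
  "adj_add C (El x) (El y) = El (x \<otimes>\<^bsub>C\<^esub> y)"
| "adj_add C Top y = y"
| "adj_add C x Top = x"

fun adj_neg :: "'c monoid \<Rightarrow> 'c adj \<Rightarrow> 'c adj" where
  "adj_neg C Top = El \<one>\<^bsub>C\<^esub>"
| "adj_neg C (El x) = (if x = \<one>\<^bsub>C\<^esub> then Top else El (inv\<^bsub>C\<^esub> x))"

definition adj_oplus ::
    "'c monoid \<Rightarrow> ('c \<Rightarrow> 'c \<Rightarrow> 'c \<Rightarrow> bool) \<Rightarrow> 'c adj \<Rightarrow> 'c adj \<Rightarrow> 'c adj" where
  "adj_oplus C R x y =
     (let s = adj_add C (x \<sqinter>\<^bsub>A_top C R\<^esub> adj_neg C y) y
      in if s \<noteq> El \<one>\<^bsub>C\<^esub> \<or> (x = El \<one>\<^bsub>C\<^esub> \<and> y = El \<one>\<^bsub>C\<^esub>) then s else Top)"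

definition distributive_lattice :: "'b gorder \<Rightarrow> bool" where
  "distributive_lattice L \<longleftrightarrow> lattice L \<and>
     (\<forall>x\<in>carrier L. \<forall>y\<in>carrier L. \<forall>z\<in>carrier L.
        x \<sqinter>\<^bsub>L\<^esub> (y \<squnion>\<^bsub>L\<^esub> z) = (x \<sqinter>\<^bsub>L\<^esub> y) \<squnion>\<^bsub>L\<^esub> (x \<sqinter>\<^bsub>L\<^esub> z))"

section \<open>The class AC\<close>

text \<open>
  The fourth condition is
  \<open>x - y = ((x \<and> -z) + z) \<and> -y - ((y \<and> -z) + z) \<and> -x\<close>, where the sums \<open>(x \<and> -z) + z\<close> and
  \<open>(y \<and> -z) + z\<close> are taken in \<open>A(C)\<close> with \<open>Top\<close> adjoined, that is, they are \<open>x \<oplus> z\<close> and \<open>y \<oplus> z\<close>: a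
  sum that vanishes in \<open>C\<close> counts as \<open>Top\<close>. The condition then expresses the associativity
  \<open>(x \<oplus> z) \<oplus> y = x \<oplus> (z \<oplus> y)\<close>. Keeping the value \<open>0\<close> instead would exclude even the circle
  \<open>\<real>/\<int>\<close> (take \<open>x = 9/10\<close>, \<open>y = 1/5\<close>, \<open>z = 1/2\<close>). Both operands of the outer difference lie
  below \<open>-y\<close> and \<open>-x\<close> respectively, so they are elements of \<open>A(C)\<close> and \<open>elt\<close> is applied to proper
  elements only.
\<close>

definition in_AC :: "'c monoid \<Rightarrow> ('c \<Rightarrow> 'c \<Rightarrow> 'c \<Rightarrow> bool) \<Rightarrow> bool" where
  "in_AC C R \<longleftrightarrow>
     pco_group C R \<and>
     (\<forall>x\<in>A_of C R - {\<one>\<^bsub>C\<^esub>}. \<forall>y\<in>A_of C R - {\<one>\<^bsub>C\<^esub>}.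
        less0 C R x y \<longleftrightarrow> less0 C R (inv\<^bsub>C\<^esub> y) (inv\<^bsub>C\<^esub> x)) \<and>
     distributive_lattice (A_top C R) \<and>
     (\<forall>x\<in>A_of C R. \<forall>y\<in>A_of C R.
        El (x \<otimes>\<^bsub>C\<^esub> y) =
        adj_add C (El x \<sqinter>\<^bsub>A_top C R\<^esub> El y) (El x \<squnion>\<^bsub>A_top C R\<^esub> El y)) \<and>
     (\<forall>x\<in>A_of C R - {\<one>\<^bsub>C\<^esub>}. \<forall>y\<in>A_of C R - {\<one>\<^bsub>C\<^esub>}. \<forall>z\<in>A_of C R - {\<one>\<^bsub>C\<^esub>}.
        x \<otimes>\<^bsub>C\<^esub> inv\<^bsub>C\<^esub> y =
        elt (adj_oplus C R (El x) (El z) \<sqinter>\<^bsub>A_top C R\<^esub> El (inv\<^bsub>C\<^esub> y)) \<otimes>\<^bsub>C\<^esub>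
        inv\<^bsub>C\<^esub> (elt (adj_oplus C R (El y) (El z) \<sqinter>\<^bsub>A_top C R\<^esub> El (inv\<^bsub>C\<^esub> x))))"

section \<open>MV-algebras\<close>

text \<open>The commutative monoid of an MV-algebra is \<open>(\<oplus>, 0)\<close>, written \<open>\<otimes>\<close> and \<open>\<one>\<close> here.\<close>

record 'a mv = "'a monoid" +
  mvneg :: "'a \<Rightarrow> 'a"

locale mv_algebra = comm_monoid M for M :: "'a mv" (structure) +
  assumes mvneg_closed: "x \<in> carrier M \<Longrightarrow> mvneg M x \<in> carrier M"
    and mvneg_mvneg: "x \<in> carrier M \<Longrightarrow> mvneg M (mvneg M x) = x"
    and mvneg_zero: "x \<in> carrier M \<Longrightarrow> x \<otimes> mvneg M \<one> = mvneg M \<one>"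
    and lukasiewicz: "\<lbrakk>x \<in> carrier M; y \<in> carrier M\<rbrakk> \<Longrightarrow>
      mvneg M (mvneg M x \<otimes> y) \<otimes> y = mvneg M (mvneg M y \<otimes> x) \<otimes> x"

definition mv_isomorphic :: "'a mv \<Rightarrow> 'b mv \<Rightarrow> bool" where
  "mv_isomorphic M N \<longleftrightarrow>
     (\<exists>f. f \<in> iso M N \<and> f \<one>\<^bsub>M\<^esub> = \<one>\<^bsub>N\<^esub> \<and>
          (\<forall>x\<in>carrier M. f (mvneg M x) = mvneg N (f x)))"

definition mv_of_pco :: "'c monoid \<Rightarrow> ('c \<Rightarrow> 'c \<Rightarrow> 'c \<Rightarrow> bool) \<Rightarrow> 'c adj mv" where
  "mv_of_pco C R =
     \<lparr>carrier = El ` A_of C R \<union> {Top}, monoid.mult = adj_oplus C R, one = El \<one>\<^bsub>C\<^esub>,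
      mvneg = adj_neg C\<rparr>"

section \<open>Unital lattice-ordered groups and their wound-rounds\<close>

definition add_group :: "'a::ab_group_add monoid" where
  "add_group = \<lparr>carrier = UNIV, monoid.mult = (+), one = 0\<rparr>"

definition zmul :: "int \<Rightarrow> 'a::ab_group_add \<Rightarrow> 'a" where
  "zmul n x = x [^]\<^bsub>add_group\<^esub> n"

definition strong_unit :: "'a::lattice_ab_group_add \<Rightarrow> bool" where
  "strong_unit u \<longleftrightarrow> 0 < u \<and> (\<forall>x. \<exists>n::nat. x \<le> zmul (int n) u)"

text \<open>\<open>inf_class.inf\<close> is the binary infimum; HOL-Algebra hides the short name.\<close>

definition Gamma :: "'a::lattice_ab_group_add \<Rightarrow> 'a mv" where
  "Gamma u = \<lparr>carrier = {0..u}, monoid.mult = (\<lambda>x y. inf_class.inf (x + y) u), one = 0,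
              mvneg = (\<lambda>x. u - x)\<rparr>"

definition int_multiples :: "'a::ab_group_add \<Rightarrow> 'a set" where
  "int_multiples u = range (\<lambda>n. zmul n u)"

definition wound_round :: "'a::lattice_ab_group_add \<Rightarrow> 'a set monoid" where
  "wound_round u = add_group Mod int_multiples u"

definition rho :: "'a::lattice_ab_group_add \<Rightarrow> 'a \<Rightarrow> 'a set" where
  "rho u x = int_multiples u #>\<^bsub>add_group\<^esub> x"

definition wound_round_R ::
    "'a::lattice_ab_group_add \<Rightarrow> 'a set \<Rightarrow> 'a set \<Rightarrow> 'a set \<Rightarrow> bool" where
  "wound_round_R u X1 X2 X3 \<longleftrightarrow>
     (\<exists>x1 x2 x3. X1 = rho u x1 \<and> X2 = rho u x2 \<and> X3 = rho u x3 \<and>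
        (\<exists>n2 n3. x1 < x2 + zmul n2 u \<and> x2 + zmul n2 u < x3 + zmul n3 u \<and>
                 x3 + zmul n3 u < x1 + u))"

end

theory Submission
  imports Defs
begin

text \<open>Every coset in \<open>A(C)\<close> has exactly one representative in \<open>{x. 0 \<le> x \<and> x < u}\<close>, and \<open><\<^sub>0\<close> is the
  order of these representatives. The excluded small intervals are the only ones in which some
  element strictly between \<open>0\<close> and \<open>u\<close> is comparable to no other such element, so all of these
  representatives occur. Sending \<open>u\<close> to the new greatest element therefore gives an order
  isomorphism from \<open>[0, u]\<close> onto \<open>A(C)\<close> with \<open>Top\<close> adjoined. Meets, joins, \<open>\<not>\<close> and \<open>\<oplus>\<close> are carried
  along it, which turns every claim into an identity between elements of \<open>[0, u]\<close>.\<close>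

section \<open>Distributivity of lattice-ordered groups\<close>

text \<open>Let \<open>d\<close> be the join of \<open>b\<close> and \<open>c\<close>, and
  \<open>m\<close> the meet of \<open>a\<close> and \<open>d\<close>. Translation by
  \<open>m - d\<close> preserves joins and carries \<open>d\<close> to \<open>m\<close>. It sends
  each \<open>e \<le> d\<close> below \<open>a\<close> because \<open>e \<le> d\<close>, and below
  \<open>e\<close> because \<open>m \<le> d\<close>.\<close>

lemma lattice_group_inf_sup_distrib:
  fixes a b c :: "'a::lattice_ab_group_add"
  shows "inf_class.inf a (sup_class.sup b c) = sup_class.sup (inf_class.inf a b) (inf_class.inf a c)"
proof (rule antisym)
  let ?d = "sup_class.sup b c"
  let ?m = "inf_class.inf a ?d"
  have shift: "?m - ?d + e \<le> inf_class.inf a e" if "e \<le> ?d" for e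
  proof (rule inf_greatest)
    have "?m + (e - ?d) \<le> ?m + 0"
      using that by (intro add_left_mono) (simp only: diff_le_0_iff_le)
    also have "\<dots> \<le> a"
      by simp
    finally show "?m - ?d + e \<le> a"
      by (simp add: algebra_simps)
    have "?m - ?d + e \<le> ?d - ?d + e"
      by (intro add_right_mono diff_right_mono) simp
    then show "?m - ?d + e \<le> e"
      by simp
  qed
  have "?m = (?m - ?d) + ?d"
    by (simp only: diff_add_cancel)
  also have "\<dots> = sup_class.sup ((?m - ?d) + b) ((?m - ?d) + c)"
    by (simp only: add_sup_distrib_left)
  also have "\<dots> \<le> sup_class.sup (inf_class.inf a b) (inf_class.inf a c)"
    by (intro sup_mono shift) simp_all
  finally show "?m \<le> sup_class.sup (inf_class.inf a b) (inf_class.inf a c)" .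
qed (rule distrib_inf_le)

section \<open>Meets and joins along an order isomorphism\<close>

text \<open>\<open>meet\<close> and \<open>join\<close> on a \<open>gorder\<close> are choice terms.
  An order isomorphism from a sublattice \<open>S\<close> of a lattice type lets them be computed in
  \<open>S\<close>. Injectivity of \<open>f\<close> follows from \<open>le_iff\<close> and
  antisymmetry.\<close>

locale lattice_chart =
  fixes S :: "'a::lattice set" and L :: "'b gorder" and f :: "'a \<Rightarrow> 'b"
  assumes inf_closed: "\<lbrakk>x \<in> S; y \<in> S\<rbrakk> \<Longrightarrow> inf_class.inf x y \<in> S"
    and sup_closed: "\<lbrakk>x \<in> S; y \<in> S\<rbrakk> \<Longrightarrow> sup_class.sup x y \<in> S"
    and carrier_eq: "carrier L = f ` S"
    and eq_eq: "eq L = (=)"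
    and le_iff: "\<lbrakk>x \<in> S; y \<in> S\<rbrakk> \<Longrightarrow> f x \<sqsubseteq>\<^bsub>L\<^esub> f y \<longleftrightarrow> x \<le> y"
begin

lemma partial_order: "partial_order L"
  by unfold_locales (auto simp: carrier_eq eq_eq le_iff intro: antisym)

lemma is_glb: "\<lbrakk>x \<in> S; y \<in> S\<rbrakk> \<Longrightarrow> greatest L (f (inf_class.inf x y)) (Lower L {f x, f y})"
  by (auto simp: greatest_def Lower_def carrier_eq le_iff inf_closed)

lemma is_lub: "\<lbrakk>x \<in> S; y \<in> S\<rbrakk> \<Longrightarrow> least L (f (sup_class.sup x y)) (Upper L {f x, f y})"
  by (auto simp: least_def Upper_def carrier_eq le_iff sup_closed)

lemma meet_eq: "\<lbrakk>x \<in> S; y \<in> S\<rbrakk> \<Longrightarrow> f x \<sqinter>\<^bsub>L\<^esub> f y = f (inf_class.inf x y)"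
  unfolding meet_def Lattice.inf_def
  using is_glb partial_order.greatest_unique[OF partial_order]
  by (metis (no_types, lifting) someI)

lemma join_eq: "\<lbrakk>x \<in> S; y \<in> S\<rbrakk> \<Longrightarrow> f x \<squnion>\<^bsub>L\<^esub> f y = f (sup_class.sup x y)"
  unfolding join_def Lattice.sup_def
  using is_lub partial_order.least_unique[OF partial_order]
  by (metis (no_types, lifting) someI)

lemma lattice: "lattice L"
proof -
  interpret partial_order L
    by (rule partial_order)
  show ?thesis
  proof unfold_locales
    show "\<exists>s. least L s (Upper L {x, y})" if "x \<in> carrier L" "y \<in> carrier L" for x y
      using that is_lub by (auto simp: carrier_eq)
    show "\<exists>s. greatest L s (Lower L {x, y})" if "x \<in> carrier L" "y \<in> carrier L" for x y
      using that is_glb by (auto simp: carrier_eq)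
  qed
qed

lemma distributive:
  assumes "\<And>x y z. \<lbrakk>x \<in> S; y \<in> S; z \<in> S\<rbrakk> \<Longrightarrow>
    inf_class.inf x (sup_class.sup y z) = sup_class.sup (inf_class.inf x y) (inf_class.inf x z)"
  shows "distributive_lattice L"
  using lattice assms
  by (auto simp: distributive_lattice_def carrier_eq meet_eq join_eq inf_closed sup_closed)

end

section \<open>The MV-algebra \<open>Gamma u\<close>\<close>

text \<open>A truncation at \<open>u\<close> before adding \<open>z\<close> is absorbed by the later
  one, since \<open>u \<le> u + z\<close>.\<close>

lemma inf_add_inf:
  fixes x y z u :: "'a::lattice_ab_group_add"
  assumes "0 \<le> z"
  shows "inf_class.inf (inf_class.inf (x + y) u + z) u = inf_class.inf (x + y + z) u"
proof -
  have "inf_class.inf (u + z) u = u"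
    using assms by (intro inf_absorb2) simp
  then show ?thesis
    by (simp add: add_inf_distrib_right inf_assoc)
qed

text \<open>The outer negation yields the join of \<open>x - y\<close> and \<open>0\<close>; adding
  \<open>y\<close> turns it into the join of \<open>x\<close> and \<open>y\<close>. Symmetry of the
  join is then the Lukasiewicz axiom.\<close>

lemma Gamma_lukasiewicz:
  fixes x y u :: "'a::lattice_ab_group_add"
  assumes "x \<le> u" "y \<le> u"
  shows "inf_class.inf (u - inf_class.inf (u - x + y) u + y) u = sup_class.sup x y"
proof -
  have "u - inf_class.inf (u - x + y) u = sup_class.sup (x - y) 0"
    by (simp add: diff_inf_eq_sup add_sup_distrib_left)
  then have "u - inf_class.inf (u - x + y) u + y = sup_class.sup x y"
    by (simp add: add_sup_distrib_right)
  then show ?thesis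
    using assms by (simp add: inf_absorb1)
qed

lemma mv_algebra_Gamma:
  fixes u :: "'a::lattice_ab_group_add"
  assumes "0 \<le> u"
  shows "mv_algebra (Gamma u)"
proof
  fix x y z
  assume "x \<in> carrier (Gamma u)" "y \<in> carrier (Gamma u)" "z \<in> carrier (Gamma u)"
  then have xyz: "0 \<le> x" "x \<le> u" "0 \<le> y" "y \<le> u" "0 \<le> z" "z \<le> u"
    by (auto simp: Gamma_def)
  \<comment> \<open>Both bracketings reduce to a single truncation of the full sum, which is
    symmetric.\<close>
  have "inf_class.inf (inf_class.inf (x + y) u + z) u = inf_class.inf (x + y + z) u"
    by (rule inf_add_inf) fact
  also have "\<dots> = inf_class.inf (inf_class.inf (y + z) u + x) u"
    by (simp add: inf_add_inf xyz) (simp add: ac_simps)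
  finally show "x \<otimes>\<^bsub>Gamma u\<^esub> y \<otimes>\<^bsub>Gamma u\<^esub> z = x \<otimes>\<^bsub>Gamma u\<^esub> (y \<otimes>\<^bsub>Gamma u\<^esub> z)"
    by (simp add: Gamma_def add.commute)
  show "mvneg (Gamma u) (mvneg (Gamma u) x \<otimes>\<^bsub>Gamma u\<^esub> y) \<otimes>\<^bsub>Gamma u\<^esub> y =
        mvneg (Gamma u) (mvneg (Gamma u) y \<otimes>\<^bsub>Gamma u\<^esub> x) \<otimes>\<^bsub>Gamma u\<^esub> x"
    using xyz by (simp add: Gamma_def Gamma_lukasiewicz sup_commute del: diff_inf_eq_sup)
qed (use assms in \<open>auto simp: Gamma_def inf_absorb1 inf_absorb2 add.commute\<close>)

section \<open>Transport of MV-algebras\<close>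

text \<open>Every element of \<open>N\<close> is a value of \<open>f\<close>, so each axiom for
  \<open>N\<close> is the image under \<open>f\<close> of the same axiom in \<open>M\<close>. The
  isomorphism from \<open>N\<close> to \<open>M\<close> is the inverse of \<open>f\<close>.\<close>

lemma mv_isomorphic_transport:
  fixes M :: "'a mv" and N :: "'b mv"
  assumes "mv_algebra M"
    and bij: "bij_betw f (carrier M) (carrier N)"
    and mult: "\<And>x y. \<lbrakk>x \<in> carrier M; y \<in> carrier M\<rbrakk> \<Longrightarrow> f (x \<otimes>\<^bsub>M\<^esub> y) = f x \<otimes>\<^bsub>N\<^esub> f y"
    and one: "f \<one>\<^bsub>M\<^esub> = \<one>\<^bsub>N\<^esub>"
    and neg: "\<And>x. x \<in> carrier M \<Longrightarrow> f (mvneg M x) = mvneg N (f x)"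
  shows "mv_algebra N" and "mv_isomorphic N M"
proof -
  interpret M: mv_algebra M
    by fact
  have carr: "carrier N = f ` carrier M"
    using bij by (simp add: bij_betw_def)
  \<comment> \<open>Read in this direction, the equations gather all operations of \<open>N\<close>
    inside one application of \<open>f\<close>.\<close>
  note rev = mult[symmetric] neg[symmetric] one[symmetric]
  show "mv_algebra N"
    by unfold_locales
      (auto simp: carr rev M.mvneg_closed M.m_assoc M.mvneg_mvneg M.mvneg_zero
        intro!: arg_cong[where f = f] intro: M.lukasiewicz M.m_comm)
  let ?g = "the_inv_into (carrier M) f"
  have g: "?g (f x) = x" if "x \<in> carrier M" for x
    using that bij by (simp add: bij_betw_def the_inv_into_f_f)
  have "?g \<in> iso N M"
    using bij_betw_the_inv_into[OF bij] by (auto simp: iso_def hom_def carr rev g)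
  then show "mv_isomorphic N M"
    unfolding mv_isomorphic_def
    by (intro exI[of _ ?g]) (auto simp: carr rev g M.mvneg_closed)
qed

section \<open>The additive group and its quotient by the multiples of \<open>u\<close>\<close>

lemma add_group_simps [simp]:
  "carrier add_group = UNIV"
  "x \<otimes>\<^bsub>add_group\<^esub> y = x + y"
  "\<one>\<^bsub>add_group\<^esub> = 0"
  by (simp_all add: add_group_def)

interpretation add_group: comm_group "add_group :: 'a::ab_group_add monoid"
  rewrites "carrier (add_group :: 'a monoid) = UNIV"
    and "monoid.mult (add_group :: 'a monoid) = (+)"
    and "one (add_group :: 'a monoid) = 0"
proof -
  show "comm_group (add_group :: 'a monoid)"
    by (rule comm_groupI) (auto simp: add_group_def ac_simps intro: exI[of _ "- x" for x])
qed (auto simp: add_group_def)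

lemma inv_add_group: "inv\<^bsub>add_group\<^esub> x = - (x::'a::ab_group_add)"
  by (rule add_group.inv_equality) auto

lemma zmul_0 [simp]: "zmul 0 x = 0"
  unfolding zmul_def by (simp add: add_group_def)

lemma zmul_1 [simp]: "zmul 1 x = x"
  unfolding zmul_def by simp

lemma zmul_add: "zmul (m + n) x = zmul m x + zmul n x"
  unfolding zmul_def using add_group.int_pow_mult by simp

lemma zmul_minus: "zmul (- n) x = - zmul n x"
  by (metis add.left_inverse eq_neg_iff_add_eq_0 zmul_0 zmul_add)

lemma subgroup_int_multiples: "subgroup (int_multiples u) add_group"
  by (rule add_group.subgroupI)
    (auto simp: int_multiples_def inv_add_group simp flip: zmul_add zmul_minus)

interpretation int_multiples: normal "int_multiples u" "add_group :: 'a::ab_group_add monoid" for u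
  by (rule add_group.subgroup_imp_normal[OF subgroup_int_multiples])

lemma rho_eq_iff: "rho u x = rho u y \<longleftrightarrow> (\<exists>n. y = x + zmul n u)"
proof -
  have rho: "rho u x = range (\<lambda>n. x + zmul n u)" for x
    by (auto simp: rho_def r_coset_def int_multiples_def add.commute)
  have shift: "rho u (x + zmul n u) = rho u x" for n
  proof -
    have "x + zmul n u + zmul k u = x + zmul (n + k) u"
      and "x + zmul k u = x + zmul n u + zmul (k - n) u" for k
      by (simp_all add: add.assoc flip: zmul_add)
    then show ?thesis
      unfolding rho by blast
  qed
  have "y = y + zmul 0 u"
    by simp
  then have "y \<in> rho u y"
    unfolding rho by blast
  then show ?thesis
    using shift rho by auto
qed

lemma carrier_wound_round: "carrier (wound_round u) = range (rho u)"
  unfolding wound_round_def carrier_FactGroup rho_def by simp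

lemma rho_add: "rho u x \<otimes>\<^bsub>wound_round u\<^esub> rho u y = rho u (x + y)"
  unfolding wound_round_def mult_FactGroup rho_def using int_multiples.rcos_sum by simp

lemma one_wound_round: "\<one>\<^bsub>wound_round u\<^esub> = rho u 0"
  unfolding wound_round_def one_FactGroup rho_def using int_multiples.subset
  by (auto simp: r_coset_def)

lemma comm_group_wound_round: "comm_group (wound_round u)"
  unfolding wound_round_def by (rule add_group.abelian_FactGroup[OF subgroup_int_multiples])

lemma inv_rho: "inv\<^bsub>wound_round u\<^esub> rho u x = rho u (- x)"
proof -
  interpret comm_group "wound_round u"
    by (rule comm_group_wound_round)
  show ?thesis
    by (rule inv_equality) (simp_all add: rho_add one_wound_round carrier_wound_round)
qed

section \<open>The cyclic order on representatives\<close>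

text \<open>A common shift by a multiple of \<open>u\<close> moves the first representative to the
  prescribed \<open>x\<close>; the integers \<open>n2\<close> and \<open>n3\<close> are absorbed
  into the other two representatives.\<close>

lemma wound_round_R_iff:
  "wound_round_R u (rho u x) Y Z \<longleftrightarrow>
    (\<exists>y z. Y = rho u y \<and> Z = rho u z \<and> x < y \<and> y < z \<and> z < x + u)"
proof
  assume "wound_round_R u (rho u x) Y Z"
  then obtain x1 x2 x3 n2 n3 where eq: "rho u x = rho u x1" "Y = rho u x2" "Z = rho u x3"
    and less: "x1 < x2 + zmul n2 u" "x2 + zmul n2 u < x3 + zmul n3 u" "x3 + zmul n3 u < x1 + u"
    unfolding wound_round_R_def by blast
  from eq(1) obtain n where x1: "x1 = x + zmul n u"
    unfolding rho_eq_iff by blast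
  let ?y = "x2 + zmul (n2 - n) u" and ?z = "x3 + zmul (n3 - n) u"
  have "?y + zmul n u = x2 + zmul n2 u" "?z + zmul n u = x3 + zmul n3 u"
    by (simp_all add: add.assoc flip: zmul_add)
  then have "x + zmul n u < ?y + zmul n u" "?y + zmul n u < ?z + zmul n u"
    "?z + zmul n u < (x + u) + zmul n u"
    using less by (simp_all add: x1 ac_simps)
  then have "x < ?y \<and> ?y < ?z \<and> ?z < x + u"
    by (simp only: add_less_cancel_right)
  moreover have "Y = rho u ?y" "Z = rho u ?z"
    using eq by (auto simp: rho_eq_iff)
  ultimately show "\<exists>y z. Y = rho u y \<and> Z = rho u z \<and> x < y \<and> y < z \<and> z < x + u"
    by blast
next
  assume "\<exists>y z. Y = rho u y \<and> Z = rho u z \<and> x < y \<and> y < z \<and> z < x + u"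
  then obtain y z where "Y = rho u y" "Z = rho u z"
    "x < y + zmul 0 u" "y + zmul 0 u < z + zmul 0 u" "z + zmul 0 u < x + u"
    by auto
  then show "wound_round_R u (rho u x) Y Z"
    unfolding wound_round_R_def by blast
qed

lemma zmul_ge:
  assumes "0 \<le> u" "0 < n"
  shows "u \<le> zmul n (u::'a::ordered_ab_group_add)"
proof -
  have "u \<le> zmul (int (Suc k)) u" for k
  proof (induction k)
    case (Suc k)
    have "u + 0 \<le> zmul (int (Suc k)) u + u"
      using Suc assms(1) by (intro add_mono) auto
    also have "\<dots> = zmul (int (Suc (Suc k))) u"
      using zmul_add[of "int (Suc k)" 1 u] by (simp add: algebra_simps)
    finally show ?case
      by simp
  qed simp
  then show ?thesis
    using assms(2) by (metis gr0_conv_Suc zero_less_imp_eq_int)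
qed

text \<open>Elements of one coset differ by some \<open>zmul n u\<close>, and
  \<open>u \<le> zmul n u\<close> for \<open>n > 0\<close>, so a nonzero shift leaves the window
  from \<open>a\<close> to \<open>a + u\<close>. The start \<open>a\<close> is free because
  \<open>R\<close> at \<open>rho u x\<close> is read in the window starting at
  \<open>x\<close>.\<close>

lemma rho_eqD:
  fixes a u x y :: "'a::lattice_ab_group_add"
  assumes u: "0 < u" and eq: "rho u x = rho u y"
    and x: "a \<le> x" "x < a + u" and y: "a \<le> y" "y < a + u"
  shows "x = y"
proof -
  have no_shift: False if "a \<le> b" "b + zmul n u < a + u" "0 < n" for b n
  proof -
    have "a + u \<le> b + zmul n u"
      using that zmul_ge[of u n] u by (intro add_mono) auto
    with that(2) show False
      by (meson leD)
  qed
  obtain n where n: "y = x + zmul n u"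
    using eq unfolding rho_eq_iff by blast
  then have n': "x = y + zmul (- n) u"
    by (simp add: zmul_minus)
  have "n = 0"
    using no_shift[of x n] no_shift[of y "- n"] x y unfolding n[symmetric] n'[symmetric]
    by (cases n "0::int" rule: linorder_cases) auto
  with n show ?thesis
    by simp
qed

section \<open>The wound-round as a partially cyclically ordered group\<close>

locale unit_interval =
  fixes u :: "'a::lattice_ab_group_add"
  assumes u_pos: "0 < u"
begin

abbreviation "C \<equiv> wound_round u"
abbreviation "R \<equiv> wound_round_R u"

lemma rho_eq_rho_iff:
  assumes "0 \<le> x" "x < u" "0 \<le> y" "y < u"
  shows "rho u x = rho u y \<longleftrightarrow> x = y"
  using rho_eqD[OF u_pos, of x y 0] assms by auto

lemma rho_add_u: "rho u (x + u) = rho u x"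
  unfolding rho_eq_iff by (rule exI[of _ "- 1"]) (simp add: zmul_minus)

lemma inv_rho_diff: "inv\<^bsub>C\<^esub> rho u x = rho u (u - x)"
  using rho_add_u[of "- x"] by (simp add: inv_rho add.commute)

lemma R_strict: "R (rho u x) Y Z \<Longrightarrow> rho u x \<noteq> Y \<and> Y \<noteq> Z \<and> Z \<noteq> rho u x"
proof -
  assume "R (rho u x) Y Z"
  then obtain y z where yz: "Y = rho u y" "Z = rho u z" "x < y" "y < z" "z < x + u"
    unfolding wound_round_R_iff by blast
  then have "x < z" "y < x + u" "x < x + u"
    using u_pos by auto
  then show ?thesis
    using yz rho_eqD[OF u_pos, of _ _ x] by (metis order.strict_implies_order less_irrefl order.refl)
qed

text \<open>The two hypotheses may choose different representatives of \<open>Z\<close>, but both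
  lie in the window starting at \<open>x\<close>, so they agree and the two chains can be
  joined.\<close>

lemma R_trans:
  assumes "R (rho u x) Y Z" "R (rho u x) Z W"
  shows "R (rho u x) Y W"
proof -
  obtain y z z' w where yz: "Y = rho u y" "Z = rho u z" "x < y" "y < z" "z < x + u"
    and zw: "Z = rho u z'" "W = rho u w" "x < z'" "z' < w" "w < x + u"
    using assms unfolding wound_round_R_iff by blast
  have "x < z" "z' < x + u"
    using yz zw by auto
  then have "z = z'"
    using rho_eqD[OF u_pos, of z z' x] yz zw by auto
  with yz zw have "y < w"
    by auto
  with yz zw show ?thesis
    unfolding wound_round_R_iff by blast
qed

text \<open>Replacing \<open>x\<close> by \<open>x + u\<close> in the same coset moves it to the end
  of the chain: \<open>y < z < x + u < y + u\<close>.\<close>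

lemma R_cyclic: "R (rho u x) Y Z \<Longrightarrow> R Y Z (rho u x)"
proof -
  assume "R (rho u x) Y Z"
  then obtain y z where yz: "Y = rho u y" "Z = rho u z" "x < y" "y < z" "z < x + u"
    unfolding wound_round_R_iff by blast
  have "rho u x = rho u (x + u)"
    by (simp add: rho_add_u)
  moreover have "x + u < y + u"
    using yz by simp
  ultimately show "R Y Z (rho u x)"
    unfolding yz(1) wound_round_R_iff using yz by blast
qed

lemma R_translate:
  assumes "R (rho u x) Y Z"
  shows "R (rho u x \<otimes>\<^bsub>C\<^esub> rho u v) (Y \<otimes>\<^bsub>C\<^esub> rho u v) (Z \<otimes>\<^bsub>C\<^esub> rho u v)"
proof -
  obtain y z where yz: "Y = rho u y" "Z = rho u z" "x < y" "y < z" "z < x + u"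
    using assms unfolding wound_round_R_iff by blast
  have "z + v < x + u + v"
    using yz by simp
  also have "\<dots> = x + v + u"
    by (simp add: ac_simps)
  finally have "x + v < y + v \<and> y + v < z + v \<and> z + v < x + v + u"
    using yz by simp
  then show ?thesis
    unfolding yz rho_add wound_round_R_iff by blast
qed

lemma pco_group: "pco_group C R"
proof -
  interpret comm_group C
    by (rule comm_group_wound_round)
  show ?thesis
  proof (rule pco_group.intro[OF comm_group_axioms], rule pco_group_axioms.intro)
    fix X
    assume "X \<in> carrier C"
    then obtain x where x: "X = rho u x"
      by (auto simp: carrier_wound_round)
    \<comment> \<open>For antisymmetry, \<open>R X Y Z\<close> and \<open>R X Z Y\<close> would give
      \<open>R X Y Y\<close> by transitivity, against strictness.\<close>
    show "partial_order \<lparr>carrier = carrier C, eq = (=), le = cle R X\<rparr>"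
      unfolding x
      by unfold_locales (auto simp: cle_def dest: R_trans R_strict)
  qed (use R_strict R_cyclic R_translate in \<open>auto simp: carrier_wound_round\<close>)
qed

text \<open>With \<open>0\<close> representing the first coset, \<open>R\<close> yields a chain
  strictly between \<open>0\<close> and \<open>u\<close>, and uniqueness of representatives
  identifies its members with \<open>x\<close> and \<open>y\<close>. The other two clauses of
  \<open>cle\<close> supply the cases \<open>x = y\<close> and \<open>x = 0\<close>.\<close>

lemma le0_iff:
  assumes "0 \<le> x" "x < u" "0 \<le> y" "y < u"
  shows "le0 C R (rho u x) (rho u y) \<longleftrightarrow> x \<le> y"
proof -
  have "R (rho u 0) (rho u x) (rho u y) \<longleftrightarrow> 0 < x \<and> x < y"
  proof
    assume "R (rho u 0) (rho u x) (rho u y)"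
    then obtain x' y' where "rho u x = rho u x'" "rho u y = rho u y'" "0 < x'" "x' < y'" "y' < u"
      unfolding wound_round_R_iff by auto
    moreover from this have "x' < u" "0 < y'"
      by auto
    ultimately show "0 < x \<and> x < y"
      using assms rho_eq_rho_iff by (metis order.strict_implies_order)
  qed (use assms in \<open>auto simp: wound_round_R_iff\<close>)
  then show ?thesis
    using assms u_pos unfolding le0_def cle_def one_wound_round
    by (auto simp: rho_eq_rho_iff order.strict_iff_order)
qed

lemma less0_iff:
  assumes "0 \<le> x" "x < u" "0 \<le> y" "y < u"
  shows "less0 C R (rho u x) (rho u y) \<longleftrightarrow> x < y"
  using assms unfolding less0_def by (auto simp: le0_iff rho_eq_rho_iff order.strict_iff_order)

lemma less0_reps:
  assumes "less0 C R X Y" "X \<noteq> \<one>\<^bsub>C\<^esub>"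
  obtains x y where "X = rho u x" "Y = rho u y" "0 < x" "x < y" "y < u"
  using assms unfolding less0_def le0_def cle_def one_wound_round wound_round_R_iff by auto

end

text \<open>If \<open>x\<close> is comparable to nothing strictly between \<open>0\<close> and \<open>u\<close>, then \<open>x \<and> y\<close> and \<open>x \<or> y\<close> are
  both trivial for every \<open>y\<close>, so \<open>y\<close> is \<open>0\<close>, \<open>u\<close>, \<open>x\<close> or a complement of \<open>x\<close>.\<close>

lemma isolated_imp_four_elements:
  fixes u x :: "'a::lattice_ab_group_add"
  assumes x: "0 < x" "x < u"
    and isolated: "\<And>y. \<lbrakk>0 < y; y < u; x \<le> y \<or> y \<le> x\<rbrakk> \<Longrightarrow> y = x"
  shows "{0..u} = {0, u, x, u - x}"
proof
  show "{0..u} \<subseteq> {0, u, x, u - x}"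
  proof
    fix y
    assume "y \<in> {0..u}"
    then have y: "0 \<le> y" "y \<le> u"
      by auto
    let ?i = "inf_class.inf x y" and ?s = "sup_class.sup x y"
    have "?i = 0 \<or> 0 < ?i" "?i < u"
      using x y by (auto simp: order.strict_iff_order[of 0] intro: inf.strict_coboundedI1)
    with isolated[of ?i] have "?i = 0 \<or> ?i = x"
      by auto
    moreover have "?s = u \<or> ?s < u" "0 < ?s"
      using x y by (auto simp: order.strict_iff_order[of _ u] intro: sup.strict_coboundedI1)
    with isolated[of ?s] have "?s = u \<or> ?s = x"
      by auto
    \<comment> \<open>Meet \<open>0\<close> with join \<open>u\<close> makes \<open>y\<close> the
      complement \<open>u - x\<close>; the other three combinations give \<open>0\<close>,
      \<open>u\<close> or \<open>x\<close>.\<close>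
    moreover have "x + y = ?s + ?i"
      by (rule add_eq_inf_sup)
    ultimately have "x + y = u \<or> y = 0 \<or> y = u \<or> y = x"
      using x by (auto simp: add.commute)
    then show "y \<in> {0, u, x, u - x}"
      by (auto simp: algebra_simps)
  qed
  show "{0, u, x, u - x} \<subseteq> {0..u}"
    using x by auto
qed

section \<open>The chart from the interval onto \<open>A(C)\<close> with \<open>Top\<close>\<close>

text \<open>The exclusion of small intervals enters in this form, which is the membership condition
  of \<open>A(C)\<close> read on representatives.\<close>

locale wound_interval = unit_interval +
  assumes comparable: "\<lbrakk>0 < x; x < u\<rbrakk> \<Longrightarrow> \<exists>y. 0 < y \<and> y < u \<and> (x < y \<or> y < x)"
begin

text \<open>A relation \<open>less0\<close> with nonzero lower coset unfolds to a chain strictly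
  between \<open>0\<close> and \<open>u\<close>, which contains a representative of
  \<open>X\<close>. Conversely, \<open>comparable\<close> supplies the nonzero partner.\<close>

lemma A_of_eq: "A_of C R = rho u ` {0..<u}"
proof (intro equalityI subsetI)
  fix X
  assume "X \<in> A_of C R"
  then consider "X = \<one>\<^bsub>C\<^esub>"
    | Y where "X \<noteq> \<one>\<^bsub>C\<^esub>" "Y \<noteq> \<one>\<^bsub>C\<^esub>" "less0 C R X Y \<or> less0 C R Y X"
    unfolding A_of_def by blast
  then show "X \<in> rho u ` {0..<u}"
  proof cases
    case 1
    then show ?thesis
      unfolding one_wound_round using u_pos by (intro image_eqI[of _ _ 0]) simp_all
  next
    case 2
    from 2(3) show ?thesis
    proof
      assume "less0 C R X Y"
      then obtain x y where "X = rho u x" "0 < x" "x < y" "y < u"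
        using 2(1) by (rule less0_reps)
      moreover from this have "x < u"
        by order
      ultimately show ?thesis
        by auto
    next
      assume "less0 C R Y X"
      then obtain y x where "X = rho u x" "0 < y" "y < x" "x < u"
        using 2(2) by (rule less0_reps)
      moreover from this have "0 < x"
        by order
      ultimately show ?thesis
        by auto
    qed
  qed
next
  fix X
  assume "X \<in> rho u ` {0..<u}"
  then obtain x where x: "X = rho u x" "0 \<le> x" "x < u"
    by auto
  show "X \<in> A_of C R"
  proof (cases "x = 0")
    case True
    then show ?thesis
      by (simp add: A_of_def x(1) one_wound_round carrier_wound_round)
  next
    case False
    with x have "0 < x"
      by auto
    from comparable[OF this x(3)] obtain y where y: "0 < y" "y < u" "x < y \<or> y < x"
      by blast
    then have "rho u y \<noteq> rho u 0"
      using u_pos by (subst rho_eq_rho_iff) auto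
    moreover have "less0 C R X (rho u y) \<or> less0 C R (rho u y) X"
      using x y by (simp add: less0_iff)
    moreover have "X \<noteq> rho u 0"
      using x u_pos False by (simp add: rho_eq_rho_iff)
    ultimately have "\<exists>Y\<in>carrier C. Y \<noteq> \<one>\<^bsub>C\<^esub> \<and> (less0 C R X Y \<or> less0 C R Y X)"
      by (intro bexI[of _ "rho u y"]) (auto simp: one_wound_round carrier_wound_round)
    moreover have "X \<in> carrier C"
      by (simp add: x(1) carrier_wound_round)
    ultimately show ?thesis
      unfolding A_of_def by simp
  qed
qed

lemma A_of_nonzeroE:
  assumes "X \<in> A_of C R - {\<one>\<^bsub>C\<^esub>}"
  obtains x where "X = rho u x" "0 < x" "x < u"
proof -
  obtain x where x: "X = rho u x" "0 \<le> x" "x < u" and "X \<noteq> rho u 0"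
    using assms unfolding A_of_eq one_wound_round by (elim DiffE imageE) simp
  then have "0 < x"
    by (auto simp: order.strict_iff_order)
  with x that show thesis
    by blast
qed

text \<open>The coset map alone would identify the two ends \<open>0\<close> and \<open>u\<close> of
  the interval.\<close>

definition chart :: "'a \<Rightarrow> 'a set adj" where
  "chart x = (if x = u then Top else El (rho u x))"

lemma chart_0: "chart 0 = El \<one>\<^bsub>C\<^esub>"
  using u_pos by (auto simp: chart_def one_wound_round)

lemma chart_u: "chart u = Top"
  by (simp add: chart_def)

lemma chart_less: "x < u \<Longrightarrow> chart x = El (rho u x)"
  by (auto simp: chart_def)

lemma chart_image: "chart ` {0..u} = El ` A_of C R \<union> {Top}"
proof -
  have "{0..u} = insert u {0..<u}"
    using u_pos by (auto simp: order.strict_iff_order)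
  then show ?thesis
    unfolding A_of_eq by (simp add: chart_u image_image chart_less)
qed

sublocale lattice_chart "{0..u}" "A_top C R" chart
proof
  show "carrier (A_top C R) = chart ` {0..u}"
    by (simp add: chart_image A_top_def)
  fix x y
  assume "x \<in> {0..u}" "y \<in> {0..u}"
  then show "chart x \<sqsubseteq>\<^bsub>A_top C R\<^esub> chart y \<longleftrightarrow> x \<le> y"
    using le0_iff[of x y] by (auto simp: chart_def A_top_def order.strict_iff_order)
qed (auto simp: A_top_def intro: le_infI1 le_supI1)

lemma inj_on_chart: "inj_on chart {0..u}"
  by (rule inj_onI) (metis order.refl order.antisym le_iff)

lemma chart_eq_iff: "\<lbrakk>0 \<le> x; x \<le> u; 0 \<le> y; y \<le> u\<rbrakk> \<Longrightarrow> chart x = chart y \<longleftrightarrow> x = y"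
  using inj_on_chart by (auto dest: inj_onD)

text \<open>\<open>Top\<close> is neutral for \<open>adj_add\<close>, in agreement with
  \<open>rho u (x + u) = rho u x\<close>. Two arguments \<open>u\<close> are excluded because
  \<open>Top + Top\<close> is \<open>Top\<close>, not a coset.\<close>

lemma adj_add_chart:
  assumes "x \<noteq> u \<or> y \<noteq> u"
  shows "adj_add C (chart x) (chart y) = El (rho u (x + y))"
  using assms rho_add_u by (auto simp: chart_def rho_add add.commute[of u])

lemma adj_neg_chart:
  assumes "0 \<le> x" "x \<le> u"
  shows "adj_neg C (chart x) = chart (u - x)"
proof (cases "x = u")
  case True
  then show ?thesis
    by (simp add: chart_u chart_0)
next
  case False
  with assms have "x < u"
    by auto
  with assms u_pos show ?thesis
    by (auto simp: chart_def inv_rho_diff one_wound_round rho_eq_rho_iff)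
qed

text \<open>Adding \<open>y\<close> to the meet of \<open>x\<close> and \<open>u - y\<close> gives
  the truncated sum. Its coset is zero both at \<open>0\<close> and at \<open>u\<close>; the case
  distinction in \<open>adj_oplus\<close> separates the two, as the value \<open>0\<close> arises
  only from \<open>x = y = 0\<close>.\<close>

lemma adj_oplus_chart:
  assumes "0 \<le> x" "x \<le> u" "0 \<le> y" "y \<le> u"
  shows "adj_oplus C R (chart x) (chart y) = chart (inf_class.inf (x + y) u)"
proof -
  let ?a = "inf_class.inf x (u - y)" and ?t = "inf_class.inf (x + y) u"
  have t: "?a + y = ?t"
    by (simp add: add_inf_distrib_right)
  have a: "0 \<le> ?a"
    using assms by simp
  have "chart x \<sqinter>\<^bsub>A_top C R\<^esub> adj_neg C (chart y) = chart ?a"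
    using assms by (simp add: adj_neg_chart meet_eq)
  \<comment> \<open>If \<open>y = u\<close> then \<open>?a \<le> u - y = 0\<close>, so
    \<open>Top + Top\<close> never occurs.\<close>
  moreover have "?a \<noteq> u \<or> y \<noteq> u"
    using u_pos a by (metis diff_self inf.cobounded2 order.strict_iff_order order.antisym)
  ultimately have s: "adj_add C (chart x \<sqinter>\<^bsub>A_top C R\<^esub> adj_neg C (chart y)) (chart y) = El (rho u ?t)"
    using adj_add_chart[of ?a y] t by simp
  have "x = 0 \<and> y = 0" if "?t = 0"
  proof -
    have ay: "?a = 0 \<and> y = 0"
      using that add_nonneg_eq_0_iff[OF a assms(3)] unfolding t by blast
    have "?a = x"
      using assms by (simp add: ay inf_absorb1)
    with ay show ?thesis
      by simp
  qed
  moreover have "x \<noteq> 0 \<or> y \<noteq> 0" if "?t = u"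
    using that u_pos by (auto simp: inf_absorb1)
  moreover have "rho u ?t = rho u 0 \<longleftrightarrow> ?t = 0" if "?t \<noteq> u"
    using that assms u_pos by (intro rho_eq_rho_iff) (auto simp: order.strict_iff_order)
  moreover have "chart v = El (rho u 0) \<longleftrightarrow> v = 0" if "0 \<le> v" "v \<le> u" for v
    using chart_eq_iff[of v 0] that u_pos by (simp add: chart_0 one_wound_round)
  ultimately show ?thesis
    using assms rho_add_u[of 0] unfolding adj_oplus_def Let_def s one_wound_round
    by (cases "?t = u") (simp_all add: chart_def)
qed

section \<open>The conditions of the class AC\<close>

lemma in_AC: "in_AC C R"
  unfolding in_AC_def
proof (intro conjI ballI)
  show "pco_group C R"
    by (rule pco_group)
  show "distributive_lattice (A_top C R)"
    by (rule distributive) (rule lattice_group_inf_sup_distrib)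
next
  fix X Y
  assume "X \<in> A_of C R" "Y \<in> A_of C R"
  then obtain x y where x: "X = rho u x" "0 \<le> x" "x < u" and y: "Y = rho u y" "0 \<le> y" "y < u"
    by (auto simp: A_of_eq)
  have X: "El X = chart x" and Y: "El Y = chart y"
    using x y by (simp_all add: chart_less)
  \<comment> \<open>The join may be \<open>u\<close>, that is, \<open>Top\<close>; since the meet is
    not, \<open>adj_add_chart\<close> applies.\<close>
  have "inf_class.inf x y \<noteq> u"
    using x by (metis inf.cobounded1 leD)
  then show "El (X \<otimes>\<^bsub>C\<^esub> Y) = adj_add C (El X \<sqinter>\<^bsub>A_top C R\<^esub> El Y) (El X \<squnion>\<^bsub>A_top C R\<^esub> El Y)"
    using x y unfolding X Y
    by (simp add: meet_eq join_eq adj_add_chart rho_add add_eq_inf_sup[of x y] add.commute)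
next
  fix X Y
  assume "X \<in> A_of C R - {\<one>\<^bsub>C\<^esub>}" "Y \<in> A_of C R - {\<one>\<^bsub>C\<^esub>}"
  then obtain x y where x: "X = rho u x" "0 < x" "x < u" and y: "Y = rho u y" "0 < y" "y < u"
    by (elim A_of_nonzeroE)
  \<comment> \<open>On representatives strictly between \<open>0\<close> and \<open>u\<close>,
    inversion is \<open>u - x\<close>, which reverses the order.\<close>
  then show "less0 C R X Y \<longleftrightarrow> less0 C R (inv\<^bsub>C\<^esub> Y) (inv\<^bsub>C\<^esub> X)"
    by (simp add: inv_rho_diff less0_iff)
  fix Z
  assume "Z \<in> A_of C R - {\<one>\<^bsub>C\<^esub>}"
  then obtain z where z: "Z = rho u z" "0 < z" "z < u"
    by (rule A_of_nonzeroE)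
  \<comment> \<open>Stated for \<open>a\<close>, \<open>b\<close> with \<open>a + b = x + y\<close>,
    this covers both operands of the fourth condition. Up to subtraction of \<open>b\<close>, the
    value depends only on \<open>x + y + z\<close>.\<close>
  have side: "elt (adj_oplus C R (El (rho u a)) (El Z) \<sqinter>\<^bsub>A_top C R\<^esub> El (inv\<^bsub>C\<^esub> (rho u b)))
      = rho u (inf_class.inf (x + y + z) u - b)"
    if ab: "0 < a" "a < u" "0 < b" "b < u" "a + b = x + y" for a b
  proof -
    let ?c = "inf_class.inf (inf_class.inf (a + z) u) (u - b)"
    have "?c \<le> u - b"
      by simp
    also have "\<dots> < u"
      using ab by simp
    \<comment> \<open>Hence \<open>chart ?c\<close> is a proper element and \<open>elt\<close>
      returns its coset.\<close>
    finally have "?c < u" .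
    have "a + z + b = (a + b) + z"
      by (simp add: ac_simps)
    then have "a + z + b = x + y + z"
      by (simp only: ab)
    moreover have "inf_class.inf (u + b) u = u"
      using ab by (simp add: inf_absorb2)
    moreover have "?c + b = inf_class.inf (inf_class.inf (a + z + b) (u + b)) u"
      by (simp add: add_inf_distrib_right)
    ultimately have "?c + b = inf_class.inf (x + y + z) u"
      by (simp only: inf_assoc)
    then have c: "?c = inf_class.inf (x + y + z) u - b"
      by (simp add: eq_diff_eq)
    have "adj_oplus C R (El (rho u a)) (El Z) \<sqinter>\<^bsub>A_top C R\<^esub> El (inv\<^bsub>C\<^esub> (rho u b)) = chart ?c"
    proof -
      have "0 \<le> a + z"
        using ab z by (intro add_nonneg_nonneg) auto
      then show ?thesis
        using ab z by (simp add: inv_rho_diff adj_oplus_chart meet_eq less_imp_le flip: chart_less)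
    qed
    then show ?thesis
      using \<open>?c < u\<close> by (simp add: chart_less c)
  qed
  \<comment> \<open>Here \<open>p\<close> is the truncation of \<open>x + y + z\<close> at
    \<open>u\<close>, common to both operands.\<close>
  have cancel: "(p - y) + - (p - x) = x + - y" for p
    by simp
  show "X \<otimes>\<^bsub>C\<^esub> inv\<^bsub>C\<^esub> Y =
      elt (adj_oplus C R (El X) (El Z) \<sqinter>\<^bsub>A_top C R\<^esub> El (inv\<^bsub>C\<^esub> Y)) \<otimes>\<^bsub>C\<^esub>
      inv\<^bsub>C\<^esub> (elt (adj_oplus C R (El Y) (El Z) \<sqinter>\<^bsub>A_top C R\<^esub> El (inv\<^bsub>C\<^esub> X)))"
    unfolding x(1) y(1) side[OF x(2,3) y(2,3) refl] side[OF y(2,3) x(2,3) add.commute]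
    by (simp only: inv_rho rho_add cancel)
qed

section \<open>The isomorphism with \<open>Gamma u\<close>\<close>

lemma mv_of_pco_isomorphic_Gamma:
  "mv_algebra (mv_of_pco C R)" "mv_isomorphic (mv_of_pco C R) (Gamma u)"
proof -
  have carr: "carrier (Gamma u) = {0..u}" "carrier (mv_of_pco C R) = chart ` {0..u}"
    unfolding chart_image by (simp_all add: Gamma_def mv_of_pco_def)
  have bij: "bij_betw chart (carrier (Gamma u)) (carrier (mv_of_pco C R))"
    unfolding carr using inj_on_chart by (rule inj_on_imp_bij_betw)
  note transport = mv_isomorphic_transport[OF mv_algebra_Gamma bij]
  show "mv_algebra (mv_of_pco C R)" "mv_isomorphic (mv_of_pco C R) (Gamma u)"
    by (rule transport;
      use u_pos in \<open>auto simp: carr Gamma_def mv_of_pco_def adj_oplus_chart adj_neg_chart chart_0\<close>)+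
qed

end

theorem theorem4p15:
  fixes u :: "'a::lattice_ab_group_add"
  assumes "strong_unit u"
    and "{0..u} \<noteq> {0, u}"
    and "\<And>x. {0..u} \<noteq> {0, u, x}"
    and "\<And>x. {0..u} \<noteq> {0, u, x, u - x}"
  shows "in_AC (wound_round u) (wound_round_R u) \<and>
         mv_algebra (mv_of_pco (wound_round u) (wound_round_R u)) \<and>
         mv_algebra (Gamma u) \<and>
         mv_isomorphic (mv_of_pco (wound_round u) (wound_round_R u)) (Gamma u)"
proof -
  have u: "0 < u"
    using assms(1) by (simp add: strong_unit_def)
  \<comment> \<open>Otherwise \<open>x\<close> would be isolated, and the interval would be
    \<open>{0, u, x, u - x}\<close>.\<close>
  have "\<exists>y. 0 < y \<and> y < u \<and> (x < y \<or> y < x)" if "0 < x" "x < u" for x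
    using isolated_imp_four_elements[OF that] assms(4)[of x] by (metis order.order_iff_strict)
  with u interpret wound_interval u
    by unfold_locales auto
  show ?thesis
    using in_AC mv_of_pco_isomorphic_Gamma mv_algebra_Gamma[of u] u by auto
qed

end
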